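(* Let $G$ be an abelian group and let $\nu \colon G \to \mathbb{R}_{\ge 0}$ be a subadditive function. Then: (1) The limit $\nu_{st}(g) = \lim_{n \to \infty} \nu(ng)/n$ exists for all $g \in G$. (2) The function $\nu_{st}\colon G \to \mathbb{R}_{\ge 0}$ is subadditive and multiplicative, that is, $\nu_{st}(ng) = n\,\nu_{st}(g)$ for all $g\in G$ and all $n \in \mathbb{Z}_{\ge 0}$. If $\nu(g) = \nu(-g)$ for all $g\in G$, then $\nu_{st}(g) = \nu_{st}(-g)$ for all $g\in G$. (3) There is a factorization of $\nu_{st}$ through $G_{\mathbb{Q}} = G \otimes \mathbb{Q}$. That is, there is a multiplicative, subadditive function $\overline{\nu}_{st} \colon G_{\mathbb{Q}} \to \mathbb{R}_{\ge 0}$ such that $\nu_{st} = \overline{\nu}_{st} \circ i$, where $i\colon G \to G_{\mathbb{Q}}$ is the map $g \mapsto g \otimes 1$.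
   Context: A function $\nu$ from an abelian group (written additively) to $\mathbb{R}_{\ge 0}$ is subadditive if $\nu(g+h) \le \nu(g)+\nu(h)$ for all $g,h$. It is multiplicative if $\nu(ng) = n\nu(g)$ for all $g$ and all integers $n\ge 0$ (on a $\mathbb{Q}$-vector space this is equivalent to $\nu(qx) = q\nu(x)$ for all $x$ and all rational $q \ge 0$). The tensor product $G\otimes\mathbb{Q}$ is over $\mathbb{Z}$. *)

theory Defs
  imports Complex_Main "HOL-Algebra.Algebra"
begin

definition subadditive_on :: "('a, 'b) monoid_scheme \<Rightarrow> ('a \<Rightarrow> real) \<Rightarrow> bool" where
  "subadditive_on G \<nu> \<longleftrightarrow>
    (\<forall>g\<in>carrier G. \<forall>h\<in>carrier G. \<nu> (g \<otimes>\<^bsub>G\<^esub> h) \<le> \<nu> g + \<nu> h)"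

text \<open>HOL-Algebra writes groups multiplicatively, so the multiple \<open>n g\<close> of an
  additively written abelian group is the power \<open>g [^] n\<close>.\<close>

definition multiplicative_on :: "('a, 'b) monoid_scheme \<Rightarrow> ('a \<Rightarrow> real) \<Rightarrow> bool" where
  "multiplicative_on G \<nu> \<longleftrightarrow>
    (\<forall>g\<in>carrier G. \<forall>n::nat. \<nu> (g [^]\<^bsub>G\<^esub> n) = real n * \<nu> g)"

text \<open>The \<open>n = 0\<close> term is \<open>0\<close> by the convention for division by zero and does not
  affect the limit.\<close>

definition stable_seq :: "('a, 'b) monoid_scheme \<Rightarrow> ('a \<Rightarrow> real) \<Rightarrow> 'a \<Rightarrow> nat \<Rightarrow> real" where
  "stable_seq G \<nu> g n = \<nu> (g [^]\<^bsub>G\<^esub> n) / real n"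

definition stabilization :: "('a, 'b) monoid_scheme \<Rightarrow> ('a \<Rightarrow> real) \<Rightarrow> 'a \<Rightarrow> real" where
  "stabilization G \<nu> g = lim (stable_seq G \<nu> g)"

text \<open>The tensor product over the integers of two abelian groups: the free abelian group
  on \<open>carrier A \<times> carrier B\<close> modulo the subgroup generated by the biadditivity relations.
  Compatibility with integer scalars follows from biadditivity.\<close>

definition tensor_relations ::
  "('a, 'm) monoid_scheme \<Rightarrow> ('b, 'n) monoid_scheme \<Rightarrow> ('a \<times> 'b \<Rightarrow>\<^sub>0 int) set" where
  "tensor_relations A B =
    {frag_of (a \<otimes>\<^bsub>A\<^esub> a', b) - (frag_of (a, b) + frag_of (a', b)) | a a' b.
       a \<in> carrier A \<and> a' \<in> carrier A \<and> b \<in> carrier B} \<union>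
    {frag_of (a, b \<otimes>\<^bsub>B\<^esub> b') - (frag_of (a, b) + frag_of (a, b')) | a b b'.
       a \<in> carrier A \<and> b \<in> carrier B \<and> b' \<in> carrier B}"

definition tensor_kernel ::
  "('a, 'm) monoid_scheme \<Rightarrow> ('b, 'n) monoid_scheme \<Rightarrow> ('a \<times> 'b \<Rightarrow>\<^sub>0 int) set" where
  "tensor_kernel A B =
    generate (free_Abelian_group (carrier A \<times> carrier B)) (tensor_relations A B)"

definition tensor_group ::
  "('a, 'm) monoid_scheme \<Rightarrow> ('b, 'n) monoid_scheme \<Rightarrow> ('a \<times> 'b \<Rightarrow>\<^sub>0 int) set monoid" where
  "tensor_group A B =
    free_Abelian_group (carrier A \<times> carrier B) Mod tensor_kernel A B"

definition pure_tensor ::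
  "('a, 'm) monoid_scheme \<Rightarrow> ('b, 'n) monoid_scheme \<Rightarrow> 'a \<Rightarrow> 'b \<Rightarrow> ('a \<times> 'b \<Rightarrow>\<^sub>0 int) set" where
  "pure_tensor A B a b =
    tensor_kernel A B #>\<^bsub>free_Abelian_group (carrier A \<times> carrier B)\<^esub> frag_of (a, b)"

definition rat_group :: "rat monoid" where
  "rat_group = \<lparr>carrier = UNIV, monoid.mult = (+), one = 0\<rparr>"

definition rationalization :: "('a, 'm) monoid_scheme \<Rightarrow> ('a \<times> rat \<Rightarrow>\<^sub>0 int) set monoid" where
  "rationalization G = tensor_group G rat_group"

definition rationalization_map ::
  "('a, 'm) monoid_scheme \<Rightarrow> 'a \<Rightarrow> ('a \<times> rat \<Rightarrow>\<^sub>0 int) set" where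
  "rationalization_map G g = pure_tensor G rat_group g 1"

lemma tensor_relations_subset:
  assumes "comm_group A" "comm_group B"
  shows "tensor_relations A B \<subseteq> carrier (free_Abelian_group (carrier A \<times> carrier B))"
proof -
  interpret A: comm_group A by fact
  interpret B: comm_group B by fact
  have "frag_of (a, b) - (frag_of (c, d) + frag_of (e, f))
      \<in> carrier (free_Abelian_group (carrier A \<times> carrier B))"
    if "a \<in> carrier A" "c \<in> carrier A" "e \<in> carrier A"
       "b \<in> carrier B" "d \<in> carrier B" "f \<in> carrier B" for a b c d e f
    using that keys_diff[of "frag_of (a, b)" "frag_of (c, d) + frag_of (e, f)"]
      keys_add[of "frag_of (c, d)" "frag_of (e, f)"]
    by fastforce
  then show ?thesis
    unfolding tensor_relations_def by auto
qed

lemma tensor_kernel_normal: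
  assumes "comm_group A" "comm_group B"
  shows "tensor_kernel A B \<lhd> free_Abelian_group (carrier A \<times> carrier B)"
  unfolding tensor_kernel_def
  by (intro comm_group.subgroup_imp_normal abelian_free_Abelian_group
      group.generate_is_subgroup group_free_Abelian_group tensor_relations_subset assms)

lemma comm_group_tensor_group:
  assumes "comm_group A" "comm_group B"
  shows "comm_group (tensor_group A B)"
  unfolding tensor_group_def
  by (intro comm_group.abelian_FactGroup abelian_free_Abelian_group
      normal_imp_subgroup tensor_kernel_normal assms)

lemma comm_group_rat_group: "comm_group rat_group"
proof (rule group.group_comm_groupI)
  show "group rat_group"
    by (rule groupI) (auto simp: rat_group_def intro: exI[of _ "- x" for x])
qed (simp add: rat_group_def)

lemma comm_group_rationalization:
  "comm_group G \<Longrightarrow> comm_group (rationalization G)"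
  unfolding rationalization_def
  by (rule comm_group_tensor_group[OF _ comm_group_rat_group])

lemma pure_tensor_closed:
  assumes "a \<in> carrier A" "b \<in> carrier B"
  shows "pure_tensor A B a b \<in> carrier (tensor_group A B)"
  using assms unfolding pure_tensor_def tensor_group_def FactGroup_def RCOSETS_def by auto

lemma pure_tensor_add:
  assumes A: "comm_group A" and B: "comm_group B"
    and ab: "a \<in> carrier A" "b \<in> carrier B" "a' \<in> carrier A" "b' \<in> carrier B"
    and c: "c \<in> carrier A" "d \<in> carrier B"
    and rel: "frag_of (c, d) - (frag_of (a, b) + frag_of (a', b')) \<in> tensor_relations A B"
  shows "pure_tensor A B c d = pure_tensor A B a b \<otimes>\<^bsub>tensor_group A B\<^esub> pure_tensor A B a' b'"
proof -
  define F where "F = free_Abelian_group (carrier A \<times> carrier B)"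
  interpret F: comm_group F
    unfolding F_def by (rule abelian_free_Abelian_group)
  interpret N: normal "tensor_kernel A B" F
    unfolding F_def by (rule tensor_kernel_normal[OF A B])
  have in_F: "frag_of (a, b) \<in> carrier F" "frag_of (a', b') \<in> carrier F"
    using ab by (auto simp: F_def)
  have sum_F: "frag_of (a, b) + frag_of (a', b') \<in> carrier F"
    using F.m_closed[OF in_F] by (simp add: F_def)
  have "frag_of (c, d) - (frag_of (a, b) + frag_of (a', b')) \<in> tensor_kernel A B"
    using rel unfolding tensor_kernel_def by (rule generate.incl)
  then have "frag_of (c, d) \<in> tensor_kernel A B #>\<^bsub>F\<^esub> (frag_of (a, b) + frag_of (a', b'))"
    unfolding r_coset_def F_def
    by (auto intro!: bexI[of _ "frag_of (c, d) - (frag_of (a, b) + frag_of (a', b'))"])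
  then have "tensor_kernel A B #>\<^bsub>F\<^esub> (frag_of (a, b) + frag_of (a', b')) =
      tensor_kernel A B #>\<^bsub>F\<^esub> frag_of (c, d)"
    by (rule F.repr_independence[OF _ sum_F N.subgroup_axioms])
  moreover have "(tensor_kernel A B #>\<^bsub>F\<^esub> frag_of (a, b)) <#>\<^bsub>F\<^esub> (tensor_kernel A B #>\<^bsub>F\<^esub> frag_of (a', b')) =
      tensor_kernel A B #>\<^bsub>F\<^esub> (frag_of (a, b) + frag_of (a', b'))"
    using N.rcos_sum[OF in_F] by (simp add: F_def)
  ultimately show ?thesis
    by (simp add: pure_tensor_def tensor_group_def F_def)
qed

lemma pure_tensor_add_left:
  assumes "comm_group A" "comm_group B" "a \<in> carrier A" "a' \<in> carrier A" "b \<in> carrier B"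
  shows "pure_tensor A B (a \<otimes>\<^bsub>A\<^esub> a') b =
    pure_tensor A B a b \<otimes>\<^bsub>tensor_group A B\<^esub> pure_tensor A B a' b"
proof -
  interpret A: comm_group A by fact
  show ?thesis
    by (rule pure_tensor_add) (use assms in \<open>auto simp: tensor_relations_def\<close>)
qed

lemma pure_tensor_add_right:
  assumes "comm_group A" "comm_group B" "a \<in> carrier A" "b \<in> carrier B" "b' \<in> carrier B"
  shows "pure_tensor A B a (b \<otimes>\<^bsub>B\<^esub> b') =
    pure_tensor A B a b \<otimes>\<^bsub>tensor_group A B\<^esub> pure_tensor A B a b'"
proof -
  interpret B: comm_group B by fact
  show ?thesis
    by (rule pure_tensor_add) (use assms in \<open>auto simp: tensor_relations_def\<close>)
qed

end

theory Submission
  imports Defs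
begin

text \<open>
  For a fixed \<open>g\<close> the sequence \<open>n \<mapsto> \<nu> (n g)\<close> is subadditive and non-negative, so the quotients
  \<open>\<nu> (n g) / n\<close> converge by Fekete's lemma (\<open>convergent_subadditive_seq\<close>). Subadditivity and
  symmetry pass to the limit because \<open>n (g + h) = n g + n h\<close> and \<open>n (- g) = - (n g)\<close>;
  multiplicativity holds because the sequence for \<open>k g\<close> is \<open>k\<close> times a subsequence of the
  sequence for \<open>g\<close>.

  The factorization rests on two facts about \<open>i : G \<rightarrow> G \<otimes> \<rat>\<close>: its kernel is torsion, and every
  element of \<open>G \<otimes> \<rat>\<close> has a positive multiple in its image. A multiplicative function \<open>\<mu>\<close> does not
  see torsion and scales along multiples, so for \<open>n x = i g\<close> the value \<open>\<mu> g / n\<close> depends on \<open>x\<close>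
  only, and it inherits subadditivity and multiplicativity
  (\<open>extend_multiplicative_along_isogeny\<close>).

  That multiples reach the image follows from \<open>b (g \<otimes> a/b) = g \<otimes> a = i (a g)\<close>, since the
  elements with this property are closed under differences. That the kernel is torsion needs maps
  out of the tensor product, but \<open>G \<otimes> \<rat>\<close> may have no non-zero homomorphism to \<open>G\<close>, as
  \<open>G = \<int>\<close> shows. Instead, an element of the subgroup of relations involves only finitely many
  rationals; as soon as \<open>M\<close> is a multiple of all their denominators, the map
  \<open>(g, q) \<mapsto> (M q) g\<close> respects the relations in question and hence kills that element
  (\<open>tensor_kernel_killed_by_scaling\<close>). If \<open>i g = 0\<close>, that element can be \<open>(g, 1)\<close>, and \<open>M g = 0\<close>.
\<close>

section \<open>Fekete's lemma\<close>

lemma subadditive_seq_mult_le: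
  fixes a :: "nat \<Rightarrow> real"
  assumes sub: "\<And>m n. a (m + n) \<le> a m + a n"
  shows "a (k * m + r) \<le> real k * a m + a r"
proof (induction k)
  case (Suc k)
  have "a (Suc k * m + r) \<le> a m + a (k * m + r)"
    using sub[of m "k * m + r"] by (simp add: add.assoc)
  with Suc show ?case by (simp add: algebra_simps)
qed simp

text \<open>The limit is the infimum of all quotients: division with remainder by an index \<open>m\<close> whose
  quotient is close to the infimum bounds every later quotient, up to an error of order \<open>1 / n\<close>
  that comes from the finitely many remainders.\<close>

lemma convergent_subadditive_seq:
  fixes a :: "nat \<Rightarrow> real"
  assumes nonneg: "\<And>n. 0 \<le> a n"
    and sub: "\<And>m n. a (m + n) \<le> a m + a n"
  shows "convergent (\<lambda>n. a n / real n)"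
proof -
  define L where "L = (INF n\<in>{1..}. a n / real n)"
  have bdd: "bdd_below ((\<lambda>n. a n / real n) ` {1..})"
    by (rule bdd_belowI[of _ 0]) (auto simp: nonneg)
  have lower: "L \<le> a n / real n" if "n \<ge> 1" for n
    unfolding L_def using that by (intro cINF_lower bdd) auto
  have "(\<lambda>n. a n / real n) \<longlonglongrightarrow> L"
  proof (rule LIMSEQ_I)
    fix e :: real
    assume "e > 0"
    then have "L < L + e / 2" by simp
    then obtain m where m: "m \<ge> 1" "a m / real m < L + e / 2"
      unfolding L_def by (subst (asm) cINF_less_iff[OF _ bdd]) auto
    define C where "C = Max (a ` {..<m})"
    have C: "a r \<le> C" if "r < m" for r
      unfolding C_def using that by (intro Max_ge) auto
    have upper: "a n / real n \<le> a m / real m + C / real n" if "n \<ge> 1" for n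
    proof -
      have "a n = a (n div m * m + n mod m)" by simp
      also have "\<dots> \<le> real (n div m) * a m + a (n mod m)"
        by (rule subadditive_seq_mult_le[OF sub])
      also have "\<dots> \<le> real n / real m * a m + C"
        using m(1) nonneg
        by (intro add_mono mult_right_mono C) (auto simp: of_nat_div_le_of_nat)
      finally show ?thesis
        using that by (simp add: field_simps)
    qed
    obtain n0 where n0: "real n0 > 2 * C / e"
      using reals_Archimedean2 by blast
    show "\<exists>n0. \<forall>n\<ge>n0. norm (a n / real n - L) < e"
    proof (intro exI allI impI)
      fix n
      assume n: "n \<ge> max 1 n0"
      then have "real n > 2 * C / e" using n0 by linarith
      then have "C / real n < e / 2"
        using n \<open>e > 0\<close> by (simp add: field_simps)
      moreover have "n \<ge> 1" using n by simp
      ultimately show "norm (a n / real n - L) < e"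
        using upper[of n] lower[of n] m(2) unfolding real_norm_def abs_less_iff by linarith
    qed
  qed
  then show ?thesis by (rule convergentI)
qed

section \<open>The stabilization of a subadditive function\<close>

lemma convergent_stable_seq:
  assumes "group G" and nonneg: "\<nu> \<in> carrier G \<rightarrow> {0..}" and sub: "subadditive_on G \<nu>"
    and g: "g \<in> carrier G"
  shows "convergent (stable_seq G \<nu> g)"
proof -
  interpret group G by fact
  have "convergent (\<lambda>n. \<nu> (g [^]\<^bsub>G\<^esub> n) / real n)"
  proof (rule convergent_subadditive_seq)
    show "0 \<le> \<nu> (g [^]\<^bsub>G\<^esub> n)" for n :: nat
      using nonneg g by (simp add: Pi_iff)
    show "\<nu> (g [^]\<^bsub>G\<^esub> (m + n)) \<le> \<nu> (g [^]\<^bsub>G\<^esub> m) + \<nu> (g [^]\<^bsub>G\<^esub> n)" for m n :: nat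
      using sub g by (simp add: subadditive_on_def flip: nat_pow_mult)
  qed
  then show ?thesis by (simp add: stable_seq_def[abs_def])
qed

lemma stable_seq_tendsto:
  assumes "group G" "\<nu> \<in> carrier G \<rightarrow> {0..}" "subadditive_on G \<nu>" "g \<in> carrier G"
  shows "stable_seq G \<nu> g \<longlonglongrightarrow> stabilization G \<nu> g"
  using convergent_stable_seq[OF assms] by (simp add: stabilization_def convergent_LIMSEQ_iff)

lemma stabilization_nonneg:
  assumes "group G" and nonneg: "\<nu> \<in> carrier G \<rightarrow> {0..}" and "subadditive_on G \<nu>"
  shows "stabilization G \<nu> \<in> carrier G \<rightarrow> {0..}"
proof
  interpret group G by fact
  fix g
  assume g: "g \<in> carrier G"
  have "0 \<le> stable_seq G \<nu> g n" for n
    using nonneg g by (simp add: stable_seq_def Pi_iff)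
  then have "0 \<le> stabilization G \<nu> g"
    by (intro LIMSEQ_le_const[OF stable_seq_tendsto[OF assms g]]) blast
  then show "stabilization G \<nu> g \<in> {0..}" by simp
qed

lemma stabilization_subadditive:
  assumes "comm_group G" and nonneg: "\<nu> \<in> carrier G \<rightarrow> {0..}" and sub: "subadditive_on G \<nu>"
  shows "subadditive_on G (stabilization G \<nu>)"
  unfolding subadditive_on_def
proof (intro ballI)
  interpret comm_group G by fact
  fix g h
  assume gh: "g \<in> carrier G" "h \<in> carrier G"
  have "stable_seq G \<nu> (g \<otimes>\<^bsub>G\<^esub> h) n \<le> stable_seq G \<nu> g n + stable_seq G \<nu> h n" for n
  proof -
    have "\<nu> ((g \<otimes>\<^bsub>G\<^esub> h) [^]\<^bsub>G\<^esub> n) \<le> \<nu> (g [^]\<^bsub>G\<^esub> n) + \<nu> (h [^]\<^bsub>G\<^esub> n)"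
      using sub gh by (simp add: subadditive_on_def nat_pow_distrib)
    then show ?thesis
      by (simp add: stable_seq_def divide_right_mono flip: add_divide_distrib)
  qed
  moreover note lim = stable_seq_tendsto[OF is_group nonneg sub]
  ultimately show
    "stabilization G \<nu> (g \<otimes>\<^bsub>G\<^esub> h) \<le> stabilization G \<nu> g + stabilization G \<nu> h"
    using gh by (intro LIMSEQ_le[OF lim tendsto_add[OF lim lim]]) auto
qed

lemma stabilization_multiplicative:
  assumes "group G" and nonneg: "\<nu> \<in> carrier G \<rightarrow> {0..}" and sub: "subadditive_on G \<nu>"
  shows "multiplicative_on G (stabilization G \<nu>)"
  unfolding multiplicative_on_def
proof (intro ballI allI)
  interpret group G by fact
  fix g and k :: nat
  assume g: "g \<in> carrier G"
  note lim = stable_seq_tendsto[OF assms]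
  have "stable_seq G \<nu> (g [^]\<^bsub>G\<^esub> k) \<longlonglongrightarrow> real k * stabilization G \<nu> g"
  proof (cases "k = 0")
    case True
    \<comment> \<open>\<open>\<nu> \<one>\<close> may be positive, but the quotients by \<open>n\<close> vanish in the limit.\<close>
    then show ?thesis
      using lim_const_over_n[of "\<nu> \<one>\<^bsub>G\<^esub>"] by (simp add: stable_seq_def[abs_def])
  next
    case False
    then have "strict_mono (\<lambda>n. k * n)" by (simp add: strict_mono_def)
    then have "(\<lambda>n. real k * stable_seq G \<nu> g (k * n)) \<longlonglongrightarrow> real k * stabilization G \<nu> g"
      using LIMSEQ_subseq_LIMSEQ[OF lim[OF g]] by (intro tendsto_mult_left) (simp add: o_def)
    moreover have "real k * stable_seq G \<nu> g (k * n) = stable_seq G \<nu> (g [^]\<^bsub>G\<^esub> k) n" for n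
      using g False by (simp add: stable_seq_def nat_pow_pow)
    ultimately show ?thesis by simp
  qed
  then show "stabilization G \<nu> (g [^]\<^bsub>G\<^esub> k) = real k * stabilization G \<nu> g"
    using LIMSEQ_unique lim g by (metis nat_pow_closed)
qed

lemma stabilization_inv:
  assumes "group G" and sym: "\<And>g. g \<in> carrier G \<Longrightarrow> \<nu> g = \<nu> (inv\<^bsub>G\<^esub> g)"
    and g: "g \<in> carrier G"
  shows "stabilization G \<nu> g = stabilization G \<nu> (inv\<^bsub>G\<^esub> g)"
proof -
  interpret group G by fact
  have "stable_seq G \<nu> g = stable_seq G \<nu> (inv\<^bsub>G\<^esub> g)"
    using g sym[OF nat_pow_closed[OF g]] by (simp add: fun_eq_iff stable_seq_def nat_pow_inv)
  then show ?thesis by (simp add: stabilization_def)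
qed

section \<open>Extending multiplicative functions\<close>

text \<open>Two relations \<open>n x = i g\<close> and \<open>m x = i h\<close> give \<open>i (m g) = i (n h)\<close>, hence
  \<open>N m g = N n h\<close> for some \<open>N > 0\<close>. This makes \<open>\<mu> g / n\<close> independent of the choice of \<open>n\<close> and \<open>g\<close>,
  although neither \<open>n\<close> nor \<open>g\<close> is determined by \<open>x\<close>.\<close>

lemma extend_multiplicative_along_isogeny:
  fixes G :: "('a, 'm) monoid_scheme" and H :: "('c, 'n) monoid_scheme"
  assumes G: "comm_group G" and H: "comm_group H" and i: "i \<in> hom G H"
    and torsion_kernel:
      "\<And>g. \<lbrakk>g \<in> carrier G; i g = \<one>\<^bsub>H\<^esub>\<rbrakk> \<Longrightarrow> \<exists>N::nat. N > 0 \<and> g [^]\<^bsub>G\<^esub> N = \<one>\<^bsub>G\<^esub>"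
    and torsion_cokernel:
      "\<And>x. x \<in> carrier H \<Longrightarrow> \<exists>n::nat. n > 0 \<and> (\<exists>g\<in>carrier G. x [^]\<^bsub>H\<^esub> n = i g)"
    and nonneg: "\<mu> \<in> carrier G \<rightarrow> {0..}"
    and sub: "subadditive_on G \<mu>" and mult: "multiplicative_on G \<mu>"
  shows "\<exists>\<mu>' \<in> carrier H \<rightarrow> {0..}. multiplicative_on H \<mu>' \<and> subadditive_on H \<mu>'
    \<and> (\<forall>g\<in>carrier G. \<mu> g = (\<mu>' \<circ> i) g)"
proof -
  interpret G: comm_group G by fact
  interpret H: comm_group H by fact
  interpret i: group_hom G H i by unfold_locales (rule i)
  define P where "P x n g \<longleftrightarrow> (n :: nat) > 0 \<and> g \<in> carrier G \<and> x [^]\<^bsub>H\<^esub> n = i g" for x n g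
  define \<mu>' where "\<mu>' x = (let (n, g) = SOME (n, g). P x n g in \<mu> g / real n)" for x
  have pow: "\<mu> (g [^]\<^bsub>G\<^esub> n) = real n * \<mu> g" if "g \<in> carrier G" for g and n :: nat
    using mult that by (auto simp: multiplicative_on_def)
  have well_defined: "\<mu> g / real n = \<mu> h / real m"
    if x: "x \<in> carrier H" and g: "P x n g" and h: "P x m h" for x n g m h
  proof -
    have gh: "g \<in> carrier G" "h \<in> carrier G" "n > 0" "m > 0" using g h by (auto simp: P_def)
    have "(x [^]\<^bsub>H\<^esub> n) [^]\<^bsub>H\<^esub> m = (x [^]\<^bsub>H\<^esub> m) [^]\<^bsub>H\<^esub> n"
      using x by (simp add: H.nat_pow_pow mult.commute)
    then have "i (g [^]\<^bsub>G\<^esub> m) = i (h [^]\<^bsub>G\<^esub> n)"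
      using g h by (simp add: P_def i.hom_nat_pow)
    then have "i (g [^]\<^bsub>G\<^esub> m \<otimes>\<^bsub>G\<^esub> inv\<^bsub>G\<^esub> (h [^]\<^bsub>G\<^esub> n)) = \<one>\<^bsub>H\<^esub>"
      using gh x by simp
    then obtain N :: nat where N: "N > 0"
      "(g [^]\<^bsub>G\<^esub> m \<otimes>\<^bsub>G\<^esub> inv\<^bsub>G\<^esub> (h [^]\<^bsub>G\<^esub> n)) [^]\<^bsub>G\<^esub> N = \<one>\<^bsub>G\<^esub>"
      using torsion_kernel gh by (meson G.inv_closed G.m_closed G.nat_pow_closed)
    then have "(g [^]\<^bsub>G\<^esub> m) [^]\<^bsub>G\<^esub> N = (h [^]\<^bsub>G\<^esub> n) [^]\<^bsub>G\<^esub> N"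
      using gh by (simp add: G.nat_pow_distrib G.nat_pow_inv G.inv_solve_right')
    then have "real N * (real m * \<mu> g) = real N * (real n * \<mu> h)"
      using gh by (metis pow G.nat_pow_closed)
    then show ?thesis using N(1) gh by (simp add: field_simps)
  qed
  have \<mu>'_eq: "\<mu>' x = \<mu> g / real n" if "x \<in> carrier H" "P x n g" for x n g
  proof -
    obtain m h where mh: "(SOME (n, g). P x n g) = (m, h)" by fastforce
    have "case (SOME (n, g). P x n g) of (n, g) \<Rightarrow> P x n g"
      by (rule someI[of "\<lambda>(n, g). P x n g" "(n, g)"]) (simp add: that)
    then have "P x m h" by (simp add: mh)
    from well_defined[OF that(1) this that(2)] show ?thesis by (simp add: \<mu>'_def mh)
  qed
  have ex: "\<exists>n g. P x n g" if "x \<in> carrier H" for x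
    using torsion_cokernel[OF that] by (auto simp: P_def)
  show ?thesis
  proof (intro bexI[of _ \<mu>'] conjI ballI)
    show "\<mu>' \<in> carrier H \<rightarrow> {0..}"
    proof
      fix x assume x: "x \<in> carrier H"
      then obtain n g where "P x n g" using ex by blast
      with \<mu>'_eq[OF x this] nonneg show "\<mu>' x \<in> {0..}" by (auto simp: P_def Pi_iff)
    qed
    show "multiplicative_on H \<mu>'"
      unfolding multiplicative_on_def
    proof (intro ballI allI)
      fix x and k :: nat
      assume x: "x \<in> carrier H"
      then obtain n g where ng: "P x n g" using ex by blast
      have "(x [^]\<^bsub>H\<^esub> k) [^]\<^bsub>H\<^esub> n = (x [^]\<^bsub>H\<^esub> n) [^]\<^bsub>H\<^esub> k"
        using x by (simp add: H.nat_pow_pow mult.commute)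
      with ng have "P (x [^]\<^bsub>H\<^esub> k) n (g [^]\<^bsub>G\<^esub> k)"
        by (auto simp: P_def i.hom_nat_pow)
      from \<mu>'_eq[OF _ this] \<mu>'_eq[OF x ng] x ng show "\<mu>' (x [^]\<^bsub>H\<^esub> k) = real k * \<mu>' x"
        by (simp add: pow P_def)
    qed
    show "subadditive_on H \<mu>'"
      unfolding subadditive_on_def
    proof (intro ballI)
      fix x y
      assume xy: "x \<in> carrier H" "y \<in> carrier H"
      then obtain n g m h where ng: "P x n g" and mh: "P y m h" using ex by meson
      then have gh: "g \<in> carrier G" "h \<in> carrier G" "n > 0" "m > 0"
        by (auto simp: P_def)
      have "(x \<otimes>\<^bsub>H\<^esub> y) [^]\<^bsub>H\<^esub> (n * m) = (x [^]\<^bsub>H\<^esub> n) [^]\<^bsub>H\<^esub> m \<otimes>\<^bsub>H\<^esub> (y [^]\<^bsub>H\<^esub> m) [^]\<^bsub>H\<^esub> n"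
        using xy by (simp add: H.nat_pow_distrib H.nat_pow_pow mult.commute)
      with ng mh have "P (x \<otimes>\<^bsub>H\<^esub> y) (n * m) (g [^]\<^bsub>G\<^esub> m \<otimes>\<^bsub>G\<^esub> h [^]\<^bsub>G\<^esub> n)"
        by (auto simp: P_def i.hom_nat_pow)
      then have "\<mu>' (x \<otimes>\<^bsub>H\<^esub> y) = \<mu> (g [^]\<^bsub>G\<^esub> m \<otimes>\<^bsub>G\<^esub> h [^]\<^bsub>G\<^esub> n) / real (n * m)"
        using xy by (intro \<mu>'_eq) auto
      also have "\<dots> \<le> (real m * \<mu> g + real n * \<mu> h) / real (n * m)"
        using sub gh by (intro divide_right_mono) (auto simp: subadditive_on_def simp flip: pow)
      also have "\<dots> = \<mu> g / real n + \<mu> h / real m"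
        using gh by (simp add: field_simps)
      also have "\<dots> = \<mu>' x + \<mu>' y"
        using \<mu>'_eq ng mh xy by simp
      finally show "\<mu>' (x \<otimes>\<^bsub>H\<^esub> y) \<le> \<mu>' x + \<mu>' y" .
    qed
    show "\<mu> g = (\<mu>' \<circ> i) g" if "g \<in> carrier G" for g
      using \<mu>'_eq[of "i g" 1 g] that by (simp add: P_def)
  qed
qed

section \<open>The map from a group to its rationalization\<close>

lemma rat_group_simps [simp]:
  "carrier rat_group = UNIV" "x \<otimes>\<^bsub>rat_group\<^esub> y = x + y" "\<one>\<^bsub>rat_group\<^esub> = 0"
  by (simp_all add: rat_group_def)

lemma rat_group_nat_pow [simp]: "q [^]\<^bsub>rat_group\<^esub> n = of_nat n * q" for n :: nat
  by (induction n) (simp_all add: algebra_simps)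

lemma rat_group_int_pow [simp]: "q [^]\<^bsub>rat_group\<^esub> k = of_int k * q" for k :: int
proof (cases k)
  case (nonneg n)
  then show ?thesis by (simp add: int_pow_int)
next
  case (neg n)
  interpret comm_group rat_group by (rule comm_group_rat_group)
  have "inv\<^bsub>rat_group\<^esub> r = - r" for r
    by (rule inv_equality) simp_all
  then have "q [^]\<^bsub>rat_group\<^esub> (- int (Suc n)) = - (of_nat (Suc n) * q)"
    by (simp only: int_pow_neg rat_group_simps UNIV_I int_pow_int rat_group_nat_pow)
  then show ?thesis by (simp only: neg of_int_minus of_int_of_nat_eq mult_minus_left)
qed

lemma pure_tensor_hom_left:
  assumes "comm_group A" "comm_group B" "b \<in> carrier B"
  shows "(\<lambda>a. pure_tensor A B a b) \<in> hom A (tensor_group A B)"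
  using assms by (intro homI) (auto simp: pure_tensor_closed pure_tensor_add_left)

lemma pure_tensor_hom_right:
  assumes "comm_group A" "comm_group B" "a \<in> carrier A"
  shows "pure_tensor A B a \<in> hom B (tensor_group A B)"
  using assms by (intro homI) (auto simp: pure_tensor_closed pure_tensor_add_right)

lemma rationalization_map_hom:
  "comm_group G \<Longrightarrow> rationalization_map G \<in> hom G (rationalization G)"
  using pure_tensor_hom_left[of G rat_group 1] comm_group_rat_group
  by (simp add: rationalization_def rationalization_map_def[abs_def])

lemma tensor_projection_hom:
  assumes "comm_group A" "comm_group B"
  shows "(\<lambda>c. tensor_kernel A B #>\<^bsub>free_Abelian_group (carrier A \<times> carrier B)\<^esub> c)
    \<in> hom (free_Abelian_group (carrier A \<times> carrier B)) (tensor_group A B)"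
  unfolding tensor_group_def by (rule normal.r_coset_hom_Mod[OF tensor_kernel_normal[OF assms]])

text \<open>With denominator \<open>b\<close>, \<open>b (g \<otimes> a/b) = g \<otimes> a = a (g \<otimes> 1)\<close>.\<close>

lemma pure_tensor_rat_pow:
  assumes G: "comm_group G" and g: "g \<in> carrier G"
  shows "\<exists>n::nat. n > 0 \<and> (\<exists>h\<in>carrier G.
    pure_tensor G rat_group g q [^]\<^bsub>rationalization G\<^esub> n = rationalization_map G h)"
proof -
  interpret G: comm_group G by fact
  interpret Q: comm_group rat_group by (rule comm_group_rat_group)
  interpret R: comm_group "rationalization G" by (rule comm_group_rationalization[OF G])
  interpret r: group_hom rat_group "rationalization G" "pure_tensor G rat_group g"
    by unfold_locales
      (simp add: rationalization_def pure_tensor_hom_right G g comm_group_rat_group)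
  interpret l: group_hom G "rationalization G" "rationalization_map G"
    by unfold_locales (rule rationalization_map_hom[OF G])
  obtain a b where ab: "quotient_of q = (a, b)" by fastforce
  then have b: "b > 0" by (rule quotient_of_denom_pos)
  have q: "of_nat (nat b) * q = of_int a"
    using quotient_of_div[OF ab] b by simp
  have "pure_tensor G rat_group g q [^]\<^bsub>rationalization G\<^esub> nat b = pure_tensor G rat_group g (of_int a)"
    using r.hom_nat_pow[of q "nat b"] q by simp
  also have "\<dots> = pure_tensor G rat_group g 1 [^]\<^bsub>rationalization G\<^esub> a"
    using r.hom_int_pow[of 1 a] by simp
  also have "\<dots> = rationalization_map G (g [^]\<^bsub>G\<^esub> a)"
    using l.hom_int_pow[OF g] by (simp add: rationalization_map_def)
  finally show ?thesis
    using b g by (intro exI[of _ "nat b"]) auto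
qed

text \<open>Elements with a positive multiple in the image of \<open>G\<close> are closed under differences, because
  \<open>n m (y - z) = m (n y) - n (m z)\<close>, and the pure tensors generate.\<close>

lemma rationalization_map_torsion_cokernel:
  assumes G: "comm_group G" and x: "x \<in> carrier (rationalization G)"
  shows "\<exists>n::nat. n > 0 \<and> (\<exists>h\<in>carrier G. x [^]\<^bsub>rationalization G\<^esub> n = rationalization_map G h)"
proof -
  define F where "F = free_Abelian_group (carrier G \<times> (UNIV :: rat set))"
  define \<pi> where "\<pi> c = tensor_kernel G rat_group #>\<^bsub>F\<^esub> c" for c
  define T where "T y \<longleftrightarrow> y \<in> carrier (rationalization G) \<and>
    (\<exists>n::nat. n > 0 \<and> (\<exists>h\<in>carrier G. y [^]\<^bsub>rationalization G\<^esub> n = rationalization_map G h))" for y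
  interpret G: comm_group G by fact
  interpret F: comm_group F unfolding F_def by (rule abelian_free_Abelian_group)
  interpret R: comm_group "rationalization G" by (rule comm_group_rationalization[OF G])
  interpret l: group_hom G "rationalization G" "rationalization_map G"
    by unfold_locales (rule rationalization_map_hom[OF G])
  interpret p: group_hom F "rationalization G" \<pi>
    using tensor_projection_hom[OF G comm_group_rat_group]
    by unfold_locales (simp add: \<pi>_def[abs_def] F_def rationalization_def)
  have T_diff: "T (y \<otimes>\<^bsub>rationalization G\<^esub> inv\<^bsub>rationalization G\<^esub> z)" if y: "T y" and z: "T z" for y z
  proof -
    obtain n m :: nat and g h where *: "n > 0" "m > 0" "g \<in> carrier G" "h \<in> carrier G"
      "y [^]\<^bsub>rationalization G\<^esub> n = rationalization_map G g"
      "z [^]\<^bsub>rationalization G\<^esub> m = rationalization_map G h"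
      using y z unfolding T_def by blast
    have yz: "y \<in> carrier (rationalization G)" "z \<in> carrier (rationalization G)"
      using y z by (auto simp: T_def)
    have "(y \<otimes>\<^bsub>rationalization G\<^esub> inv\<^bsub>rationalization G\<^esub> z) [^]\<^bsub>rationalization G\<^esub> (n * m) =
        (y [^]\<^bsub>rationalization G\<^esub> n) [^]\<^bsub>rationalization G\<^esub> m \<otimes>\<^bsub>rationalization G\<^esub>
        inv\<^bsub>rationalization G\<^esub> ((z [^]\<^bsub>rationalization G\<^esub> m) [^]\<^bsub>rationalization G\<^esub> n)"
      using yz by (simp add: R.nat_pow_distrib R.nat_pow_pow R.nat_pow_inv mult.commute)
    also have "\<dots> = rationalization_map G (g [^]\<^bsub>G\<^esub> m \<otimes>\<^bsub>G\<^esub> inv\<^bsub>G\<^esub> (h [^]\<^bsub>G\<^esub> n))"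
      using * by (simp add: l.hom_nat_pow)
    finally show ?thesis
      unfolding T_def using * yz
      by (intro conjI exI[of _ "n * m"]
          bexI[of _ "g [^]\<^bsub>G\<^esub> m \<otimes>\<^bsub>G\<^esub> inv\<^bsub>G\<^esub> (h [^]\<^bsub>G\<^esub> n)"]) auto
  qed
  obtain c where c: "c \<in> carrier F" "x = \<pi> c"
    using x by (auto simp: rationalization_def tensor_group_def FactGroup_def RCOSETS_def
        \<pi>_def F_def)
  from c(1) have "Poly_Mapping.keys c \<subseteq> carrier G \<times> UNIV" by (simp add: F_def)
  \<comment> \<open>Membership in \<open>F\<close> is carried along, since \<open>\<pi>\<close> is a homomorphism only there.\<close>
  then have "c \<in> carrier F \<and> T (\<pi> c)"
  proof (induction c rule: frag_induction)
    case zero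
    have "T (\<one>\<^bsub>rationalization G\<^esub>)"
      unfolding T_def by (intro conjI exI[of _ 1] bexI[of _ "\<one>\<^bsub>G\<^esub>"]) auto
    then show ?case using p.hom_one F.one_closed by (simp add: F_def)
  next
    case (one y)
    then obtain g q where gq: "y = (g, q)" "g \<in> carrier G" by blast
    then have "frag_of y \<in> carrier F" by (simp add: F_def)
    moreover from this have "\<pi> (frag_of y) \<in> carrier (rationalization G)" by simp
    ultimately show ?case
      using pure_tensor_rat_pow[OF G gq(2), of q] gq
      by (simp add: T_def \<pi>_def F_def pure_tensor_def)
  next
    case (diff a b)
    then have ab: "a \<in> carrier F" "b \<in> carrier F" by auto
    have eq: "a - b = a \<otimes>\<^bsub>F\<^esub> inv\<^bsub>F\<^esub> b" using ab by (simp add: F_def)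
    show ?case unfolding eq using ab T_diff diff by simp
  qed
  then show ?thesis using c by (simp add: T_def)
qed

lemma floor_mult_denominator:
  assumes "snd (quotient_of q) dvd int M"
  shows "of_int \<lfloor>of_nat M * q\<rfloor> = of_nat M * q"
proof -
  obtain a b where ab: "quotient_of q = (a, b)" by fastforce
  with assms obtain k where k: "int M = b * k" by auto
  have b: "b > 0" using ab by (rule quotient_of_denom_pos)
  have "of_nat M * q = of_int (int M) * (of_int a / of_int b)"
    using quotient_of_div[OF ab] by simp
  also have "\<dots> = of_int (k * a)" using b by (simp add: k)
  finally show ?thesis by simp
qed

text \<open>The homomorphism induced by \<open>(g, q) \<mapsto> \<lfloor>M q\<rfloor> g\<close> always respects additivity in \<open>g\<close>, and it
  respects additivity in \<open>q\<close> once \<open>M\<close> clears the denominators in question. For each \<open>N\<close>, the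
  elements killed for every multiple \<open>M\<close> of \<open>N\<close> form a subgroup, and these subgroups are directed
  under divisibility of \<open>N\<close>; their union is a subgroup that contains all the relations.\<close>

lemma tensor_kernel_killed_by_scaling:
  assumes G: "comm_group G"
    and \<Phi>: "\<And>M. \<Phi> M \<in> hom (free_Abelian_group (carrier G \<times> (UNIV :: rat set))) G"
    and \<Phi>_frag: "\<And>M g q. g \<in> carrier G \<Longrightarrow> \<Phi> M (frag_of (g, q)) = g [^]\<^bsub>G\<^esub> \<lfloor>of_nat M * q\<rfloor>"
    and c: "c \<in> tensor_kernel G rat_group"
  shows "\<exists>N::nat. N > 0 \<and> (\<forall>M. N dvd M \<longrightarrow> \<Phi> M c = \<one>\<^bsub>G\<^esub>)"
proof -
  define F where "F = free_Abelian_group (carrier G \<times> (UNIV :: rat set))"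
  define S where "S = {c \<in> carrier F. \<exists>N::nat. N > 0 \<and> (\<forall>M. N dvd M \<longrightarrow> \<Phi> M c = \<one>\<^bsub>G\<^esub>)}"
  interpret G: comm_group G by fact
  interpret F: comm_group F unfolding F_def by (rule abelian_free_Abelian_group)
  have "group_hom F G (\<Phi> M)" for M
    using \<Phi> by unfold_locales (simp add: F_def)
  then interpret \<Phi>: group_hom F G "\<Phi> M" for M .
  have "subgroup S F"
  proof (rule F.subgroupI)
    show "S \<subseteq> carrier F" by (auto simp: S_def)
    have "\<one>\<^bsub>F\<^esub> \<in> S" by (auto simp: S_def)
    then show "S \<noteq> {}" by blast
    show "inv\<^bsub>F\<^esub> a \<in> S" if "a \<in> S" for a
      using that by (auto simp: S_def intro!: exI)
    show "a \<otimes>\<^bsub>F\<^esub> b \<in> S" if ab: "a \<in> S" "b \<in> S" for a b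
    proof -
      obtain N N' :: nat where "N > 0" "N' > 0"
        "\<And>M. N dvd M \<Longrightarrow> \<Phi> M a = \<one>\<^bsub>G\<^esub>" "\<And>M. N' dvd M \<Longrightarrow> \<Phi> M b = \<one>\<^bsub>G\<^esub>"
        using ab by (auto simp: S_def)
      then have "N * N' > 0 \<and> (\<forall>M. N * N' dvd M \<longrightarrow> \<Phi> M (a \<otimes>\<^bsub>F\<^esub> b) = \<one>\<^bsub>G\<^esub>)"
        using ab by (auto simp: S_def dest: dvd_mult_left dvd_mult_right)
      moreover have "a \<otimes>\<^bsub>F\<^esub> b \<in> carrier F" using ab by (simp add: S_def)
      ultimately show ?thesis unfolding S_def by blast
    qed
  qed
  moreover have "tensor_relations G rat_group \<subseteq> S"
  proof
    fix x
    assume x: "x \<in> tensor_relations G rat_group"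
    then have xF: "x \<in> carrier F"
      using tensor_relations_subset[OF G comm_group_rat_group]
      by (auto simp: F_def simp del: carrier_free_Abelian_group_iff)
    have \<Phi>_rel: "\<Phi> M (frag_of u - (frag_of v + frag_of w)) =
        \<Phi> M (frag_of u) \<otimes>\<^bsub>G\<^esub> inv\<^bsub>G\<^esub> (\<Phi> M (frag_of v) \<otimes>\<^bsub>G\<^esub> \<Phi> M (frag_of w))"
      if "fst u \<in> carrier G" "fst v \<in> carrier G" "fst w \<in> carrier G" for M u v w
    proof -
      have F: "frag_of u \<in> carrier F" "frag_of v \<in> carrier F" "frag_of w \<in> carrier F"
        using that by (auto simp: F_def mem_Times_iff)
      then have "frag_of v + frag_of w \<in> carrier F"
        using F.m_closed[OF F(2,3)] by (simp add: F_def)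
      then have "frag_of u - (frag_of v + frag_of w) =
          frag_of u \<otimes>\<^bsub>F\<^esub> inv\<^bsub>F\<^esub> (frag_of v \<otimes>\<^bsub>F\<^esub> frag_of w)"
        by (simp add: F_def)
      then show ?thesis using F by simp
    qed
    consider (left) a a' b where
        "x = frag_of (a \<otimes>\<^bsub>G\<^esub> a', b) - (frag_of (a, b) + frag_of (a', b))"
        "a \<in> carrier G" "a' \<in> carrier G"
      | (right) a b b' where
        "x = frag_of (a, b + b') - (frag_of (a, b) + frag_of (a, b'))" "a \<in> carrier G"
      using x by (auto simp: tensor_relations_def)
    then show "x \<in> S"
    proof cases
      case left
      then have "\<Phi> M x = \<one>\<^bsub>G\<^esub>" for M
        by (simp add: \<Phi>_rel \<Phi>_frag G.int_pow_distrib)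
      then show ?thesis using xF by (auto simp: S_def)
    next
      case right
      define N where "N = nat (snd (quotient_of b) * snd (quotient_of b'))"
      have pos: "snd (quotient_of b) > 0" "snd (quotient_of b') > 0"
        by (simp_all add: quotient_of_denom_pos')
      have "\<Phi> M x = \<one>\<^bsub>G\<^esub>" if "N dvd M" for M
      proof -
        have "snd (quotient_of b) * snd (quotient_of b') dvd int M"
          using that pos by (auto simp: N_def nat_dvd_iff zero_less_mult_iff)
        then have "snd (quotient_of b) dvd int M" "snd (quotient_of b') dvd int M"
          by (auto dest: dvd_mult_left dvd_mult_right)
        then have "of_nat M * (b + b') = of_int (\<lfloor>of_nat M * b\<rfloor> + \<lfloor>of_nat M * b'\<rfloor>)"
          by (simp add: floor_mult_denominator distrib_left)
        then have "\<lfloor>of_nat M * (b + b')\<rfloor> = \<lfloor>of_nat M * b\<rfloor> + \<lfloor>of_nat M * b'\<rfloor>"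
          by (simp only: floor_of_int)
        then show ?thesis
          using right by (simp add: \<Phi>_rel \<Phi>_frag G.int_pow_mult)
      qed
      moreover have "N > 0" using pos by (simp add: N_def)
      ultimately show ?thesis using xF by (auto simp: S_def)
    qed
  qed
  ultimately have "tensor_kernel G rat_group \<subseteq> S"
    unfolding tensor_kernel_def using F.generate_subgroup_incl by (simp add: F_def)
  then show ?thesis using c by (auto simp: S_def)
qed

lemma rationalization_map_torsion_kernel:
  assumes G: "comm_group G" and g: "g \<in> carrier G"
    and ker: "rationalization_map G g = \<one>\<^bsub>rationalization G\<^esub>"
  shows "\<exists>N::nat. N > 0 \<and> g [^]\<^bsub>G\<^esub> N = \<one>\<^bsub>G\<^esub>"
proof -
  define F where "F = free_Abelian_group (carrier G \<times> (UNIV :: rat set))"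
  interpret G: comm_group G by fact
  interpret F: comm_group F unfolding F_def by (rule abelian_free_Abelian_group)
  interpret N: normal "tensor_kernel G rat_group" F
    using tensor_kernel_normal[OF G comm_group_rat_group] by (simp add: F_def)
  have "frag_of (g, 1) \<in> tensor_kernel G rat_group #>\<^bsub>F\<^esub> frag_of (g, 1)"
    using g by (intro F.rcos_self N.subgroup_axioms) (simp add: F_def)
  also have "\<dots> = tensor_kernel G rat_group"
    using ker by (simp add: rationalization_map_def pure_tensor_def rationalization_def
        tensor_group_def FactGroup_def F_def)
  finally have mem: "frag_of (g, 1) \<in> tensor_kernel G rat_group" .
  have "\<exists>h. h \<in> hom F G \<and> (\<forall>a\<in>carrier G. \<forall>q. h (frag_of (a, q)) = a [^]\<^bsub>G\<^esub> \<lfloor>of_nat M * q\<rfloor>)"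
    for M :: nat
  proof -
    obtain h where "h \<in> hom F G"
      "\<And>x. x \<in> carrier G \<times> UNIV \<Longrightarrow> h (frag_of x) = fst x [^]\<^bsub>G\<^esub> \<lfloor>of_nat M * snd x\<rfloor>"
      unfolding F_def
      by (rule G.free_Abelian_group_universal[of
            "\<lambda>x. fst x [^]\<^bsub>G\<^esub> \<lfloor>of_nat M * snd x\<rfloor>" "carrier G \<times> UNIV"]) auto
    then show ?thesis by (intro exI[of _ h]) simp
  qed
  then obtain \<Phi> where "\<And>M. \<Phi> M \<in> hom F G"
    and \<Phi>: "\<And>M a q. a \<in> carrier G \<Longrightarrow> \<Phi> M (frag_of (a, q)) = a [^]\<^bsub>G\<^esub> \<lfloor>of_nat M * q\<rfloor>"
    by metis
  then obtain N where "N > 0" "\<Phi> N (frag_of (g, 1)) = \<one>\<^bsub>G\<^esub>"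
    using tensor_kernel_killed_by_scaling[OF G _ _ mem, of \<Phi>] by (auto simp: F_def)
  then show ?thesis using \<Phi>[OF g, of N 1] by (auto simp: int_pow_int)
qed

section \<open>Stabilization through the rationalization\<close>

theorem theorem1:
  fixes G :: "('a, 'b) monoid_scheme" and \<nu> :: "'a \<Rightarrow> real"
  assumes "comm_group G"
    and "\<nu> \<in> carrier G \<rightarrow> {0..}"
    and "subadditive_on G \<nu>"
  shows "(\<forall>g\<in>carrier G. convergent (stable_seq G \<nu> g))
    \<and> (stabilization G \<nu> \<in> carrier G \<rightarrow> {0..}
       \<and> subadditive_on G (stabilization G \<nu>)
       \<and> multiplicative_on G (stabilization G \<nu>)
       \<and> ((\<forall>g\<in>carrier G. \<nu> g = \<nu> (inv\<^bsub>G\<^esub> g)) \<longrightarrow>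
            (\<forall>g\<in>carrier G. stabilization G \<nu> g = stabilization G \<nu> (inv\<^bsub>G\<^esub> g))))
    \<and> (\<exists>\<nu>' \<in> carrier (rationalization G) \<rightarrow> {0..}.
         multiplicative_on (rationalization G) \<nu>'
         \<and> subadditive_on (rationalization G) \<nu>'
         \<and> (\<forall>g\<in>carrier G. stabilization G \<nu> g = (\<nu>' \<circ> rationalization_map G) g))"
proof -
  interpret comm_group G by fact
  note stab = stabilization_nonneg[OF is_group assms(2,3)] stabilization_subadditive[OF assms]
    stabilization_multiplicative[OF is_group assms(2,3)]
  have "(\<forall>g\<in>carrier G. \<nu> g = \<nu> (inv\<^bsub>G\<^esub> g)) \<longrightarrow>
      (\<forall>g\<in>carrier G. stabilization G \<nu> g = stabilization G \<nu> (inv\<^bsub>G\<^esub> g))"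
    using stabilization_inv[OF is_group, of \<nu>] by blast
  moreover have "\<forall>g\<in>carrier G. convergent (stable_seq G \<nu> g)"
    using convergent_stable_seq[OF is_group assms(2,3)] by blast
  moreover note extend_multiplicative_along_isogeny[OF assms(1)
      comm_group_rationalization[OF assms(1)] rationalization_map_hom[OF assms(1)]
      rationalization_map_torsion_kernel[OF assms(1)]
      rationalization_map_torsion_cokernel[OF assms(1)] stab]
  ultimately show ?thesis
    using stab by (intro conjI)
qed

end
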